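(* Let $A$ be a nonempty set, let $\mathscr{M}[A]$ be the free magma on $A$, let $\mathscr{S}[A]$ be the free semigroup on $A$, and let $\mathscr{M}[X]$ be the free magma on a singleton set $\{X\}$. Let $\pi_1$ and $\pi_2$ denote the canonical projections of the direct product of magmas $\mathscr{M}[X] \times \mathscr{S}[A]$ onto $\mathscr{M}[X]$ and $\mathscr{S}[A]$, respectively. There is a unique injective magma morphism $\phi : \mathscr{M}[A] \to \mathscr{M}[X] \times \mathscr{S}[A]$ such that (i) $\pi_1 \circ \phi$ is surjective and is constant on the subset $A$ of $\mathscr{M}[A]$, and (ii) $\pi_2 \circ \phi$ restricted to $A$ is the inclusion map $\iota_A : A \to \mathscr{S}[A]$. Moreover, up to isomorphism, $\mathscr{M}[X]$ is the unique magma with this property; that is, if $M'$ is a magma for which there is a unique injective magma morphism $\phi' : \mathscr{M}[A] \to M' \times \mathscr{S}[A]$ satisfying (i) and (ii) with $\phi'$ in place of $\phi$ and with $\pi_1, \pi_2$ replaced by the canonical projections of $M' \times \mathscr{S}[A]$ onto $M'$ and $\mathscr{S}[A]$, then $M'$ is isomorphic to $\mathscr{M}[X]$.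
   Context: A magma is a set with a binary operation (no axioms). The free magma $\mathscr{M}[A]$ contains $A$ as its set of free generators. The free semigroup $\mathscr{S}[A]$ is the set of all nonempty finite sequences $f : \{1,\dots,n\} \to A$ ($n \geq 1$) with concatenation as operation; $A$ is viewed as a subset of $\mathscr{S}[A]$ by identifying $a\in A$ with the length-one sequence $a$. The direct product of two magmas has the componentwise operation. *)

theory Defs
  imports "HOL-Algebra.Congruence" "HOL-Analysis.Abstract_Topology_2"
begin

record 'a magma = "'a partial_object" +
  mop :: "['a, 'a] \<Rightarrow> 'a"  (infixl \<open>\<cdot>\<index>\<close> 70)

locale magma =
  fixes M (structure)
  assumes mop_closed: "\<lbrakk>x \<in> carrier M; y \<in> carrier M\<rbrakk> \<Longrightarrow> x \<cdot> y \<in> carrier M"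

text \<open>
  Morphisms are extensional functions on the carrier, so that two morphisms are equal in HOL
  exactly if they agree on the carrier; uniqueness of a morphism then has its usual meaning.
\<close>

definition magma_hom :: "'a magma \<Rightarrow> 'b magma \<Rightarrow> ('a \<Rightarrow> 'b) set" where
  "magma_hom M N =
    {h. h \<in> carrier M \<rightarrow>\<^sub>E carrier N \<and>
        (\<forall>x\<in>carrier M. \<forall>y\<in>carrier M. h (x \<cdot>\<^bsub>M\<^esub> y) = h x \<cdot>\<^bsub>N\<^esub> h y)}"

definition magma_isomorphic :: "'a magma \<Rightarrow> 'b magma \<Rightarrow> bool" where
  "magma_isomorphic M N \<longleftrightarrow> (\<exists>h\<in>magma_hom M N. bij_betw h (carrier M) (carrier N))"

definition magma_prod :: "'a magma \<Rightarrow> 'b magma \<Rightarrow> ('a \<times> 'b) magma" where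
  "magma_prod M N =
    \<lparr>carrier = carrier M \<times> carrier N,
     mop = (\<lambda>(x, u) (y, v). (x \<cdot>\<^bsub>M\<^esub> y, u \<cdot>\<^bsub>N\<^esub> v))\<rparr>"

datatype (gens: 'a) magma_term = Gen 'a | Node "'a magma_term" "'a magma_term"

definition free_magma :: "'a set \<Rightarrow> 'a magma_term magma" where
  "free_magma A = \<lparr>carrier = {t. gens t \<subseteq> A}, mop = Node\<rparr>"

definition free_semigroup :: "'a set \<Rightarrow> 'a list magma" where
  "free_semigroup A = \<lparr>carrier = lists A - {[]}, mop = (@)\<rparr>"

text \<open>
  \<open>A\<close> is a subset of the free magma via \<open>Gen\<close>, and a subset of the free semigroup
  via \<open>\<lambda>a. [a]\<close>. The canonical projections of a product are \<open>fst\<close> and \<open>snd\<close>.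
\<close>

definition free_magma_embedding ::
    "'a set \<Rightarrow> 'm magma \<Rightarrow> ('a magma_term \<Rightarrow> 'm \<times> 'a list) \<Rightarrow> bool" where
  "free_magma_embedding A M \<phi> \<longleftrightarrow>
     \<phi> \<in> magma_hom (free_magma A) (magma_prod M (free_semigroup A)) \<and>
     inj_on \<phi> (carrier (free_magma A)) \<and>
     (fst \<circ> \<phi>) ` carrier (free_magma A) = carrier M \<and>
     (fst \<circ> \<phi>) constant_on (Gen ` A) \<and>
     (\<forall>a\<in>A. (snd \<circ> \<phi>) (Gen a) = [a])"

lemma magma_free_magma: "magma (free_magma A)"
  by (simp add: magma_def free_magma_def)

lemma magma_free_semigroup: "magma (free_semigroup A)"
  by (auto simp: magma_def free_semigroup_def)

lemma magma_magma_prod: "magma M \<Longrightarrow> magma N \<Longrightarrow> magma (magma_prod M N)"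
  by (auto simp: magma_def magma_prod_def)

lemma free_magma_universal:
  assumes "magma N" and f: "f \<in> A \<rightarrow> carrier N"
  shows "\<exists>!h. h \<in> magma_hom (free_magma A) N \<and> (\<forall>a\<in>A. h (Gen a) = f a)"
proof (rule ex_ex1I)
  define ev where "ev = rec_magma_term f (\<lambda>_ _ u v. u \<cdot>\<^bsub>N\<^esub> v)"
  have ev: "ev t \<in> carrier N" if "gens t \<subseteq> A" for t
    using that f assms(1) by (induction t) (auto simp: ev_def magma_def)
  show "\<exists>h. h \<in> magma_hom (free_magma A) N \<and> (\<forall>a\<in>A. h (Gen a) = f a)"
    by (rule exI[of _ "restrict ev {t. gens t \<subseteq> A}"])
      (use ev in \<open>auto simp: magma_hom_def free_magma_def ev_def\<close>)
next
  fix h k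
  assume h: "h \<in> magma_hom (free_magma A) N \<and> (\<forall>a\<in>A. h (Gen a) = f a)"
    and k: "k \<in> magma_hom (free_magma A) N \<and> (\<forall>a\<in>A. k (Gen a) = f a)"
  have "h t = k t" if "gens t \<subseteq> A" for t
    using that h k by (induction t) (auto simp: magma_hom_def free_magma_def)
  moreover have "h \<in> extensional {t. gens t \<subseteq> A}" "k \<in> extensional {t. gens t \<subseteq> A}"
    using h k by (auto simp: magma_hom_def free_magma_def PiE_def)
  ultimately show "h = k"
    by (auto intro: extensionalityI)
qed

end

theory Submission
  imports Defs
begin

text \<open>
  A term over \<open>A\<close> is determined by two pieces of data: its shape, obtained by replacing every
  generator by \<open>X\<close>, and the word of its leaves read from left to right. Both are magma
  morphisms, so a morphism \<open>\<phi>\<close> into \<open>M \<times> \<S>[A]\<close> with \<open>\<phi> a = (c, a)\<close> for all \<open>a\<close> in \<open>A\<close> must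
  be \<open>\<phi> t = (g (shape t), leaves t)\<close>, where \<open>g\<close> is the morphism from the free magma on \<open>X\<close> to
  \<open>M\<close> that sends \<open>X\<close> to \<open>c\<close> (\<open>hom_eq_shape_leaves\<close>).

  For \<open>M\<close> the free magma on \<open>X\<close>, surjectivity onto the indecomposable element \<open>X\<close> forces
  \<open>c = X\<close>. Then \<open>g\<close> is the identity, and \<open>\<phi>\<close> is injective because shape and leaves together
  determine a term.

  For an arbitrary \<open>M'\<close>, surjectivity of the first component of \<open>\<phi>'\<close> makes \<open>g\<close> surjective, and it
  remains to see that \<open>g\<close> is injective
  (\<open>magma_isomorphic_if_free_magma_embedding\<close>). A priori \<open>g\<close> could identify shapes with different numbers
  of leaves without spoiling injectivity of \<open>\<phi>'\<close>. Suppose \<open>g s = g s'\<close>. The shapes \<open>s \<cdot> s'\<close> and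
  \<open>s' \<cdot> s\<close> then have the same image under \<open>g\<close> and have equally many leaves. Labelling
  all leaves by one fixed generator gives two terms with the same image under \<open>\<phi>'\<close>. So
  \<open>s \<cdot> s' = s' \<cdot> s\<close>, and hence \<open>s = s'\<close> because products in a free magma factor uniquely.
\<close>

section \<open>Shapes and leaf words\<close>

abbreviation shape :: "'x \<Rightarrow> 'a magma_term \<Rightarrow> 'x magma_term" where
  "shape x \<equiv> map_magma_term (\<lambda>_. x)"

primrec leaves :: "'a magma_term \<Rightarrow> 'a list" where
  "leaves (Gen a) = [a]"
| "leaves (Node s t) = leaves s @ leaves t"

lemma gens_shape: "gens (shape x t) \<subseteq> {x}"
  by (induction t) auto

lemma shape_eq_self: "gens s \<subseteq> {x} \<Longrightarrow> shape x s = s"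
  by (induction s) auto

lemma shape_shape: "shape x (shape y t) = shape x t"
  by (induction t) auto

lemma length_leaves_eq_if_shape_eq:
  "shape x s = shape x t \<Longrightarrow> length (leaves s) = length (leaves t)"
proof (induction s arbitrary: t)
  case (Gen a)
  then show ?case by (cases t) auto
next
  case (Node s1 s2)
  from Node.prems obtain t1 t2 where t: "t = Node t1 t2"
    and sh: "shape x s1 = shape x t1" "shape x s2 = shape x t2"
    by (cases t) auto
  show ?case
    using Node.IH(1)[OF sh(1)] Node.IH(2)[OF sh(2)] by (simp add: t)
qed

text \<open>
  The common shape of two products fixes where the leaf word has to be cut into the leaf words of
  the factors, so the factors can be compared separately.
\<close>

lemma eq_if_shape_eq_leaves_eq:
  "shape x s = shape x t \<Longrightarrow> leaves s = leaves t \<Longrightarrow> s = t"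
proof (induction s arbitrary: t)
  case (Gen a)
  then show ?case by (cases t) auto
next
  case (Node s1 s2)
  from Node.prems(1) obtain t1 t2 where t: "t = Node t1 t2"
    and sh: "shape x s1 = shape x t1" "shape x s2 = shape x t2"
    by (cases t) auto
  have "leaves s1 = leaves t1 \<and> leaves s2 = leaves t2"
    using Node.prems(2) length_leaves_eq_if_shape_eq[OF sh(1)] by (simp add: t)
  then show ?case
    using Node.IH sh t by blast
qed

lemma leaves_shape: "leaves (shape x t) = replicate (length (leaves t)) x"
  by (induction t) (auto simp: replicate_add)

section \<open>Morphisms out of a free magma\<close>

text \<open>
  Both components of the right-hand side are compatible with products, so agreement on the
  generators suffices. Letting \<open>g\<close> be any morphism, rather than the identity only, makes the lemma
  serve the existence part (\<open>g\<close> the identity) as well as the characterisation of \<open>M'\<close> (\<open>g\<close> the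
  candidate isomorphism).
\<close>

lemma hom_eq_shape_leaves:
  assumes h: "h \<in> magma_hom (free_magma A) (magma_prod M (free_semigroup A))"
    and hG: "\<And>a. a \<in> A \<Longrightarrow> h (Gen a) = (g (Gen x), [a])"
    and g: "g \<in> magma_hom (free_magma {x}) M"
    and t: "gens t \<subseteq> A"
  shows "h t = (g (shape x t), leaves t)"
  using t
proof (induction t)
  case (Gen a)
  then show ?case using hG by simp
next
  case (Node s t)
  have "h (Node s t) = mop (magma_prod M (free_semigroup A)) (h s) (h t)"
    using h Node.prems by (simp add: magma_hom_def free_magma_def)
  moreover have "g (Node (shape x s) (shape x t)) = mop M (g (shape x s)) (g (shape x t))"
    using g by (simp add: magma_hom_def free_magma_def gens_shape)
  ultimately show ?case
    using Node by (simp add: magma_prod_def free_semigroup_def)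
qed

lemma free_magma_embedding_Gen:
  assumes "free_magma_embedding A M \<phi>" and "A \<noteq> {}"
  obtains c where "c \<in> carrier M" and "\<And>a. a \<in> A \<Longrightarrow> \<phi> (Gen a) = (c, [a])"
proof -
  from assms(1) obtain c where c: "\<And>a. a \<in> A \<Longrightarrow> fst (\<phi> (Gen a)) = c"
    by (auto simp: free_magma_embedding_def constant_on_def)
  have "\<phi> (Gen a) = (c, [a])" if "a \<in> A" for a
    using assms(1) c that by (auto simp: free_magma_embedding_def prod_eq_iff)
  moreover from assms(2) obtain a where "a \<in> A" by blast
  then have "c \<in> carrier M"
    using assms(1) c[of a] by (auto simp: free_magma_embedding_def free_magma_def)
  ultimately show thesis using that by blast
qed

text \<open>
  The element \<open>X\<close> is not a product, so only a generator can be mapped to it.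
\<close>

lemma free_magma_embedding_singleton_Gen:
  assumes emb: "free_magma_embedding A (free_magma {X}) \<phi>" and "A \<noteq> {}" and a: "a \<in> A"
  shows "\<phi> (Gen a) = (Gen X, [a])"
proof -
  obtain c where c: "\<And>a. a \<in> A \<Longrightarrow> \<phi> (Gen a) = (c, [a])"
    using free_magma_embedding_Gen[OF emb \<open>A \<noteq> {}\<close>] by blast
  have "Gen X \<in> (fst \<circ> \<phi>) ` carrier (free_magma A)"
    using emb by (simp add: free_magma_embedding_def free_magma_def)
  then obtain t where t: "gens t \<subseteq> A" "fst (\<phi> t) = Gen X"
    by (auto simp: free_magma_def)
  have "c = Gen X"
  proof (cases t)
    case (Gen b)
    then show ?thesis using t c[of b] by simp
  next
    case (Node u v)
    then have "\<phi> t = mop (magma_prod (free_magma {X}) (free_semigroup A)) (\<phi> u) (\<phi> v)"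
      using emb t(1) by (simp add: free_magma_embedding_def magma_hom_def free_magma_def)
    then have "fst (\<phi> t) = Node (fst (\<phi> u)) (fst (\<phi> v))"
      by (simp add: magma_prod_def free_magma_def split_beta)
    then show ?thesis using t(2) by simp
  qed
  then show ?thesis using c a by simp
qed

lemma magma_isomorphic_sym:
  assumes "magma M" and "magma_isomorphic M N"
  shows "magma_isomorphic N M"
proof -
  from assms(2) obtain h where h: "h \<in> magma_hom M N" and bij: "bij_betw h (carrier M) (carrier N)"
    by (auto simp: magma_isomorphic_def)
  define k where "k = restrict (inv_into (carrier M) h) (carrier N)"
  have k_in: "k y \<in> carrier M" and hk: "h (k y) = y" if "y \<in> carrier N" for y
    using bij that by (auto simp: k_def bij_betw_def inv_into_into f_inv_into_f)
  have kh: "k (h x) = x" if "x \<in> carrier M" for x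
    using bij that by (auto simp: k_def bij_betw_def)
  have "k (mop N x y) = mop M (k x) (k y)" if "x \<in> carrier N" "y \<in> carrier N" for x y
  proof -
    have "mop N x y = h (mop M (k x) (k y))"
      using h k_in hk that by (simp add: magma_hom_def)
    then show ?thesis
      using kh magma.mop_closed[OF assms(1)] k_in that by simp
  qed
  then have "k \<in> magma_hom N M"
    using k_in by (auto simp: magma_hom_def k_def)
  moreover have "bij_betw k (carrier N) (carrier M)"
    using bij_betw_inv_into[OF bij] by (simp add: k_def cong: bij_betw_cong)
  ultimately show ?thesis
    by (auto simp: magma_isomorphic_def)
qed

section \<open>The embedding and its uniqueness\<close>

lemma free_magma_embedding_singleton_exists:
  assumes "A \<noteq> {}"
  shows "\<exists>\<phi>. free_magma_embedding A (free_magma {X}) \<phi>"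
proof -
  let ?N = "magma_prod (free_magma {X}) (free_semigroup A)"
  have "magma ?N"
    by (intro magma_magma_prod magma_free_magma magma_free_semigroup)
  moreover have "(\<lambda>a. (Gen X, [a])) \<in> A \<rightarrow> carrier ?N"
    by (auto simp: magma_prod_def free_magma_def free_semigroup_def)
  ultimately obtain \<phi> where \<phi>: "\<phi> \<in> magma_hom (free_magma A) ?N"
    and \<phi>G: "\<And>a. a \<in> A \<Longrightarrow> \<phi> (Gen a) = (Gen X, [a])"
    using free_magma_universal[of ?N "\<lambda>a. (Gen X, [a])" A] by blast
  have id: "restrict id (carrier (free_magma {X})) \<in> magma_hom (free_magma {X}) (free_magma {X})"
    by (auto simp: magma_hom_def free_magma_def)
  have eq: "\<phi> t = (shape X t, leaves t)" if "gens t \<subseteq> A" for t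
    using hom_eq_shape_leaves[OF \<phi> _ id that] \<phi>G by (simp add: free_magma_def gens_shape)
  have "inj_on \<phi> (carrier (free_magma A))"
    by (rule inj_onI, rule eq_if_shape_eq_leaves_eq[of X])
      (use eq in \<open>simp_all add: free_magma_def\<close>)
  moreover have "(fst \<circ> \<phi>) ` carrier (free_magma A) = carrier (free_magma {X})"
  proof (intro equalityI subsetI)
    fix s assume "s \<in> (fst \<circ> \<phi>) ` carrier (free_magma A)"
    then show "s \<in> carrier (free_magma {X})"
      by (auto simp: free_magma_def eq intro!: gens_shape[THEN subsetD, THEN singletonD])
  next
    fix s assume "s \<in> carrier (free_magma {X})"
    then have s: "gens s \<subseteq> {X}" by (simp add: free_magma_def)
    obtain a where a: "a \<in> A" using assms by blast
    have gens: "gens (shape a s) \<subseteq> A"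
      using gens_shape[of a s] a by blast
    then have "s = (fst \<circ> \<phi>) (shape a s)"
      using eq s by (simp add: shape_shape shape_eq_self)
    then show "s \<in> (fst \<circ> \<phi>) ` carrier (free_magma A)"
      using gens by (auto simp: free_magma_def)
  qed
  ultimately have "free_magma_embedding A (free_magma {X}) \<phi>"
    using \<phi> \<phi>G by (auto simp: free_magma_embedding_def constant_on_def)
  then show ?thesis by (intro exI)
qed

lemma free_magma_embedding_singleton_unique:
  assumes "A \<noteq> {}" and "free_magma_embedding A (free_magma {X}) \<phi>"
    and "free_magma_embedding A (free_magma {X}) \<psi>"
  shows "\<phi> = \<psi>"
proof -
  let ?N = "magma_prod (free_magma {X}) (free_semigroup A)"
  have "magma ?N"
    by (intro magma_magma_prod magma_free_magma magma_free_semigroup)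
  moreover have "(\<lambda>a. (Gen X, [a])) \<in> A \<rightarrow> carrier ?N"
    by (auto simp: magma_prod_def free_magma_def free_semigroup_def)
  ultimately have "\<exists>!h. h \<in> magma_hom (free_magma A) ?N \<and> (\<forall>a\<in>A. h (Gen a) = (Gen X, [a]))"
    by (rule free_magma_universal)
  moreover have "\<chi> \<in> magma_hom (free_magma A) ?N \<and> (\<forall>a\<in>A. \<chi> (Gen a) = (Gen X, [a]))"
    if "free_magma_embedding A (free_magma {X}) \<chi>" for \<chi>
    using free_magma_embedding_singleton_Gen[OF that assms(1)] that
    by (simp add: free_magma_embedding_def)
  ultimately show ?thesis
    using assms(2,3) by blast
qed

section \<open>The first factor is free on one generator\<close>

lemma magma_isomorphic_if_free_magma_embedding:
  assumes "A \<noteq> {}" and "magma M" and emb: "free_magma_embedding A M \<phi>"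
  shows "magma_isomorphic M (free_magma {X})"
proof -
  obtain c where c: "c \<in> carrier M" and \<phi>G: "\<And>a. a \<in> A \<Longrightarrow> \<phi> (Gen a) = (c, [a])"
    using free_magma_embedding_Gen[OF emb assms(1)] by blast
  obtain g where g: "g \<in> magma_hom (free_magma {X}) M" and gX: "g (Gen X) = c"
    using free_magma_universal[OF assms(2), of "\<lambda>_. c" "{X}"] c by auto
  have \<phi>: "\<phi> \<in> magma_hom (free_magma A) (magma_prod M (free_semigroup A))"
    using emb by (simp add: free_magma_embedding_def)
  have inj: "inj_on \<phi> (carrier (free_magma A))"
    using emb by (simp add: free_magma_embedding_def)
  have eq: "\<phi> t = (g (shape X t), leaves t)" if "gens t \<subseteq> A" for t
    using hom_eq_shape_leaves[OF \<phi> _ g that] \<phi>G gX by simp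
  obtain a where a: "a \<in> A" using assms(1) by blast
  have gens_a: "gens (shape a s) \<subseteq> A" for s :: "'c magma_term"
    using gens_shape[of a s] a by blast
  have "inj_on g (carrier (free_magma {X}))"
  proof (rule inj_onI)
    fix s s' assume "s \<in> carrier (free_magma {X})" "s' \<in> carrier (free_magma {X})"
      and g_eq: "g s = g s'"
    then have s: "gens s \<subseteq> {X}" "gens s' \<subseteq> {X}"
      by (simp_all add: free_magma_def)
    have g_Node: "g (Node s s') = g (Node s' s)"
      using g s g_eq by (simp add: magma_hom_def free_magma_def)
    \<comment> \<open>All leaves carry the label \<open>a\<close>, so the two leaf words are equal once their lengths agree.\<close>
    have "leaves (shape a (Node s s')) = leaves (shape a (Node s' s))"
      unfolding leaves_shape by (simp add: add.commute)
    then have "\<phi> (shape a (Node s s')) = \<phi> (shape a (Node s' s))"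
      unfolding eq[OF gens_a] shape_shape
      using g_Node s by (simp add: shape_eq_self)
    then have "shape a (Node s s') = shape a (Node s' s)"
      by (rule inj_onD[OF inj]) (simp_all only: free_magma_def partial_object.simps mem_Collect_eq gens_a)
    then have "shape a s = shape a s'"
      unfolding magma_term.map magma_term.inject by (rule conjunct1)
    then have "shape X (shape a s) = shape X (shape a s')"
      by (rule arg_cong)
    then show "s = s'"
      using s by (simp add: shape_shape shape_eq_self)
  qed
  moreover have "g ` carrier (free_magma {X}) = carrier M"
  proof (intro equalityI subsetI)
    fix y assume "y \<in> g ` carrier (free_magma {X})"
    then show "y \<in> carrier M" using g by (auto simp: magma_hom_def)
  next
    fix y assume "y \<in> carrier M"
    then have "y \<in> (fst \<circ> \<phi>) ` carrier (free_magma A)"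
      using emb by (simp add: free_magma_embedding_def)
    then obtain t where "gens t \<subseteq> A" "y = fst (\<phi> t)"
      by (auto simp: free_magma_def)
    then show "y \<in> g ` carrier (free_magma {X})"
      using eq gens_shape[of X t] by (auto simp: free_magma_def)
  qed
  ultimately have "magma_isomorphic (free_magma {X}) M"
    using g by (auto simp: magma_isomorphic_def bij_betw_def)
  then show ?thesis
    using magma_isomorphic_sym magma_free_magma by blast
qed

theorem theorem1:
  fixes A :: "'a set" and X :: 'x
  assumes "A \<noteq> {}"
  shows "(\<exists>!\<phi>. free_magma_embedding A (free_magma {X}) \<phi>) \<and>
    (\<forall>M' :: 'm magma. magma M' \<longrightarrow> (\<exists>!\<phi>'. free_magma_embedding A M' \<phi>') \<longrightarrow>
       magma_isomorphic M' (free_magma {X}))"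
proof (intro conjI allI impI)
  show "\<exists>!\<phi>. free_magma_embedding A (free_magma {X}) \<phi>"
  proof (rule ex_ex1I)
    show "\<exists>\<phi>. free_magma_embedding A (free_magma {X}) \<phi>"
      by (rule free_magma_embedding_singleton_exists[OF assms])
  next
    fix \<phi> \<psi>
    assume "free_magma_embedding A (free_magma {X}) \<phi>" "free_magma_embedding A (free_magma {X}) \<psi>"
    then show "\<phi> = \<psi>"
      by (rule free_magma_embedding_singleton_unique[OF assms])
  qed
next
  fix M' :: "'m magma"
  assume "magma M'" and "\<exists>!\<phi>'. free_magma_embedding A M' \<phi>'"
  from this(2) obtain \<phi>' where "free_magma_embedding A M' \<phi>'"
    by (rule ex1E)
  then show "magma_isomorphic M' (free_magma {X})"
    by (rule magma_isomorphic_if_free_magma_embedding[OF assms \<open>magma M'\<close>])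
qed

end
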